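(* Let $\phi=F\wedge\forall x.\,Q$ be a formula in the fragment described in the context, and let $B=[b_{\min},b_{\max}]$ be a non-empty integer interval. Assume that the formula \[ \Bigl(F \wedge \bigwedge_{z \in B} Q[x\mapsto\hat z]\Bigr) \wedge \Bigl(\bigvee_{\mathcal{S}\subseteq \mathcal{T}}\Psi^+(B,\mathcal{S})\Bigr)\wedge \Bigl(\bigvee_{\mathcal{S}'\subseteq \mathcal{T}}\Psi^-(B,\mathcal{S}')\Bigr) \] is satisfiable. Then the formula $F \wedge \bigwedge_{z \in B} Q[x\mapsto\hat z]\wedge \forall x.\; (x\notin B \Rightarrow Q)$ has a satisfiability certificate, and hence $\phi$ is satisfiable.
   Context: Fragment. We work in linear integer arithmetic with uninterpreted function symbols (SMTLIB UFLIA). $\phi=F\wedge\forall x.\,Q$ where $F,Q$ are quantifier-free, $x$ is a single integer variable, every uninterpreted function symbol has arity $0$ (uninterpreted constants) or $1$ with integer argument and integer value, arguments of unary uninterpreted function symbols are linear integer terms containing no unary uninterpreted function symbols (they may contain integers, uninterpreted constants and, in $Q$, $x$), and for each unary $f$ occurring in $Q$ all argument terms of $f$ in $Q$ have the same coefficient of $x$; $\sigma_f\in\{+,-\}$ denotes the sign of this coefficient (which is assumed nonzero). $\hat z$ is the numeral for $z\in\mathbb{Z}$, $s[x\mapsto t]$ is substitution, and $args(F,f)$ is the set of argument terms of $f$ in $F$. Signs multiply as usual ($ss'=+$ iff $s=s'$); for integers, $z\lessdot_+ z'$ means $z<z'$ and $z\lessdot_- z'$ means $z>z'$. For $B=[b_{\min},b_{\max}]$,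 $B^-=b_{\min}$, $B^+=b_{\max}$; $x\notin B$ abbreviates $x<b_{\min}\vee x>b_{\max}$. Let $\mathcal F$ be the set of unary uninterpreted function symbols in $Q$ and $\mathcal T$ the set of terms $f(t)$ occurring in $Q$ with $f\in\mathcal F$. For $\mathcal S\subseteq\mathcal T$ and $s\in\{+,-\}$: - Extremal condition $\Phi^s_{\rm ext}(\mathcal S)$: the formula $\bigwedge_{f\in\mathcal F}\bigl(\bigwedge_{f(t),f(t')\in\mathcal S} t=t' \wedge \bigwedge_{f(t)\in\mathcal S,\ f(t')\in\mathcal T\setminus\mathcal S} t'\lessdot_{\sigma_f s} t\bigr)$ with $x$ replaced by $\hat 0$ (here $f(t),f(t')$ range over terms with the same head symbol $f$). - Propagability condition $\Phi_{\rm prop}(\mathcal S)$: $\forall x\,\forall\bar u\,\exists\bar v.\ Q'(\mathcal S)$, where $\bar u=(u_{f(t)})_{f(t)\in\mathcal T\setminus\mathcal S}$, $\bar v=(v_{f(t)})_{f(t)\in\mathcal S}$ are fresh integer variables and $Q'(\mathcal S)$ is $Q$ with each $f(t)\in\mathcal T\setminus\mathcal S$ replaced by $u_{f(t)}$ and each $f(t)\in\mathcal S$ replaced by $v_{f(t)}$ simultaneously. - $\Psi^s(B,\mathcal S):=\Phi^s_{\rm ext}(\mathcal S)\wedge\Phi_{\rm prop}(\mathcal S)\wedge\bigwedge_{f(t)\in\mathcal S}\bigwedge_{a\in args(F,f)} a\lessdot_{\sigma_f s} t[x\mapsto \widehat{B^s}]$. Satisfiability certificate (for a formula $G\wedge\forall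 x.\,P$ with $G,P$ quantifier-free in this language). A cell is a term $f(n)$ with $f$ unary uninterpreted and $n\in\mathbb{Z}$, or an uninterpreted constant. A cell interpretation is a partial map $I$ from cells to $\mathbb{Z}$ with domain $\mathit{def}(I)$; for a term $t$, $I(t)$ is the common value of $t$ under all interpretations agreeing with $I$ on $\mathit{def}(I)$, or $\bot$ if not unique; $I\models\psi$ means all such interpretations satisfy $\psi$. A pre-satisfiability certificate is a finite cell interpretation $I$ with $I\models G$ and $I(t[x\mapsto\hat z])\neq\bot$ for all $z\in\mathbb{Z}$ and all argument terms $t$ of uninterpreted symbols in $P$. Relevant cells: $\Gamma_{I,z}=\{f(I(t[x\mapsto\hat z]))\mid f(t)\text{ occurs in } P\}$. A satisfiability certificate consists of a pre-satisfiability certificate $I$, a well-order $\preceq$ on $\mathbb{Z}$, and for each $z\in\mathbb{Z}$ a set $X_z\subseteq\Gamma_{I,z}$ with $X_z\cap\mathit{def}(I)=\emptyset$ and $X_z\cap\bigcup_{z'\prec z}\Gamma_{I,z'}=\emptyset$, together with a witness that for all values of the cells in $\Gamma_{I,z}\setminus\mathit{def}(I)\setminus X_z$ there exist values for the cells of $X_z$ such that $I$ extended by these values satisfies $P[x\mapsto\hat z]$.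
   Formalization: The propagability condition additionally requires v_{f(t)} = v_{f(t')} for all f(t), f(t') in S with the same symbol f; without this the claim fails, e.g. F: c=d, Q: x=0 or (f(x+c)=0 and f(x+d)=1), B=[0,0], S=S'={f(x+c), f(x+d)}. *)

theory Defs
  imports Main
begin

section \<open>Syntax\<close>

text \<open>
  Linear integer terms over unary symbols \<open>'f\<close> and constants \<open>'c\<close>; the only multiplication is by a
  numeral.  \<open>X\<close> is the variable \<open>x\<close> of the fragment.  \<open>U f t\<close> and \<open>V f t\<close> are the variables
  indexed by the term \<open>f(t)\<close>; formulas of the fragment contain no variable but \<open>X\<close>, so these are
  always fresh.
\<close>

datatype ('f, 'c) trm =
    Var "('f, 'c) var"
  | Num int
  | Const 'c
  | App 'f "('f, 'c) trm"
  | Add "('f, 'c) trm" "('f, 'c) trm"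
  | Sub "('f, 'c) trm" "('f, 'c) trm"
  | Uminus "('f, 'c) trm"
  | Mul int "('f, 'c) trm"
and ('f, 'c) var =
    X
  | U 'f "('f, 'c) trm"
  | V 'f "('f, 'c) trm"

datatype ('f, 'c) fm =
    TrueF
  | FalseF
  | EqF "('f, 'c) trm" "('f, 'c) trm"
  | LeF "('f, 'c) trm" "('f, 'c) trm"
  | LtF "('f, 'c) trm" "('f, 'c) trm"
  | DvdF int "('f, 'c) trm"
  | NotF "('f, 'c) fm"
  | AndF "('f, 'c) fm" "('f, 'c) fm"
  | OrF "('f, 'c) fm" "('f, 'c) fm"
  | ImpF "('f, 'c) fm" "('f, 'c) fm"
  | IffF "('f, 'c) fm" "('f, 'c) fm"
  | AllF "('f, 'c) var" "('f, 'c) fm"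
  | ExF "('f, 'c) var" "('f, 'c) fm"

abbreviation conj_list :: "('f, 'c) fm list \<Rightarrow> ('f, 'c) fm" where
  "conj_list \<phi>s \<equiv> foldr AndF \<phi>s TrueF"

abbreviation disj_list :: "('f, 'c) fm list \<Rightarrow> ('f, 'c) fm" where
  "disj_list \<phi>s \<equiv> foldr OrF \<phi>s FalseF"

primrec trm_vars :: "('f, 'c) trm \<Rightarrow> ('f, 'c) var set" where
  "trm_vars (Var v) = {v}"
| "trm_vars (Num n) = {}"
| "trm_vars (Const c) = {}"
| "trm_vars (App f t) = trm_vars t"
| "trm_vars (Add t u) = trm_vars t \<union> trm_vars u"
| "trm_vars (Sub t u) = trm_vars t \<union> trm_vars u"
| "trm_vars (Uminus t) = trm_vars t"
| "trm_vars (Mul k t) = trm_vars t"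

primrec free_vars :: "('f, 'c) fm \<Rightarrow> ('f, 'c) var set" where
  "free_vars TrueF = {}"
| "free_vars FalseF = {}"
| "free_vars (EqF t u) = trm_vars t \<union> trm_vars u"
| "free_vars (LeF t u) = trm_vars t \<union> trm_vars u"
| "free_vars (LtF t u) = trm_vars t \<union> trm_vars u"
| "free_vars (DvdF k t) = trm_vars t"
| "free_vars (NotF \<phi>) = free_vars \<phi>"
| "free_vars (AndF \<phi> \<psi>) = free_vars \<phi> \<union> free_vars \<psi>"
| "free_vars (OrF \<phi> \<psi>) = free_vars \<phi> \<union> free_vars \<psi>"
| "free_vars (ImpF \<phi> \<psi>) = free_vars \<phi> \<union> free_vars \<psi>"
| "free_vars (IffF \<phi> \<psi>) = free_vars \<phi> \<union> free_vars \<psi>"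
| "free_vars (AllF v \<phi>) = free_vars \<phi> - {v}"
| "free_vars (ExF v \<phi>) = free_vars \<phi> - {v}"

primrec qfree :: "('f, 'c) fm \<Rightarrow> bool" where
  "qfree TrueF = True"
| "qfree FalseF = True"
| "qfree (EqF t u) = True"
| "qfree (LeF t u) = True"
| "qfree (LtF t u) = True"
| "qfree (DvdF k t) = True"
| "qfree (NotF \<phi>) = qfree \<phi>"
| "qfree (AndF \<phi> \<psi>) = (qfree \<phi> \<and> qfree \<psi>)"
| "qfree (OrF \<phi> \<psi>) = (qfree \<phi> \<and> qfree \<psi>)"
| "qfree (ImpF \<phi> \<psi>) = (qfree \<phi> \<and> qfree \<psi>)"
| "qfree (IffF \<phi> \<psi>) = (qfree \<phi> \<and> qfree \<psi>)"
| "qfree (AllF v \<phi>) = False"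
| "qfree (ExF v \<phi>) = False"

text \<open>Occurrences of unary symbols; the pair \<open>(f, t)\<close> represents the term \<open>f(t)\<close>.\<close>

primrec trm_apps :: "('f, 'c) trm \<Rightarrow> ('f \<times> ('f, 'c) trm) list" where
  "trm_apps (Var v) = []"
| "trm_apps (Num n) = []"
| "trm_apps (Const c) = []"
| "trm_apps (App f t) = (f, t) # trm_apps t"
| "trm_apps (Add t u) = trm_apps t @ trm_apps u"
| "trm_apps (Sub t u) = trm_apps t @ trm_apps u"
| "trm_apps (Uminus t) = trm_apps t"
| "trm_apps (Mul k t) = trm_apps t"

primrec apps :: "('f, 'c) fm \<Rightarrow> ('f \<times> ('f, 'c) trm) list" where
  "apps TrueF = []"
| "apps FalseF = []"
| "apps (EqF t u) = trm_apps t @ trm_apps u"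
| "apps (LeF t u) = trm_apps t @ trm_apps u"
| "apps (LtF t u) = trm_apps t @ trm_apps u"
| "apps (DvdF k t) = trm_apps t"
| "apps (NotF \<phi>) = apps \<phi>"
| "apps (AndF \<phi> \<psi>) = apps \<phi> @ apps \<psi>"
| "apps (OrF \<phi> \<psi>) = apps \<phi> @ apps \<psi>"
| "apps (ImpF \<phi> \<psi>) = apps \<phi> @ apps \<psi>"
| "apps (IffF \<phi> \<psi>) = apps \<phi> @ apps \<psi>"
| "apps (AllF v \<phi>) = apps \<phi>"
| "apps (ExF v \<phi>) = apps \<phi>"

definition args :: "('f, 'c) fm \<Rightarrow> 'f \<Rightarrow> ('f, 'c) trm list" where
  "args \<phi> f = remdups [t. (g, t) \<leftarrow> apps \<phi>, g = f]"

text \<open>The substitution \<open>[v \<mapsto> n]\<close> of a numeral, which cannot cause variable capture.\<close>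

primrec trm_subst :: "('f, 'c) var \<Rightarrow> int \<Rightarrow> ('f, 'c) trm \<Rightarrow> ('f, 'c) trm" where
  "trm_subst v n (Var w) = (if w = v then Num n else Var w)"
| "trm_subst v n (Num m) = Num m"
| "trm_subst v n (Const c) = Const c"
| "trm_subst v n (App f t) = App f (trm_subst v n t)"
| "trm_subst v n (Add t u) = Add (trm_subst v n t) (trm_subst v n u)"
| "trm_subst v n (Sub t u) = Sub (trm_subst v n t) (trm_subst v n u)"
| "trm_subst v n (Uminus t) = Uminus (trm_subst v n t)"
| "trm_subst v n (Mul k t) = Mul k (trm_subst v n t)"

primrec subst :: "('f, 'c) var \<Rightarrow> int \<Rightarrow> ('f, 'c) fm \<Rightarrow> ('f, 'c) fm" where
  "subst v n TrueF = TrueF"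
| "subst v n FalseF = FalseF"
| "subst v n (EqF t u) = EqF (trm_subst v n t) (trm_subst v n u)"
| "subst v n (LeF t u) = LeF (trm_subst v n t) (trm_subst v n u)"
| "subst v n (LtF t u) = LtF (trm_subst v n t) (trm_subst v n u)"
| "subst v n (DvdF k t) = DvdF k (trm_subst v n t)"
| "subst v n (NotF \<phi>) = NotF (subst v n \<phi>)"
| "subst v n (AndF \<phi> \<psi>) = AndF (subst v n \<phi>) (subst v n \<psi>)"
| "subst v n (OrF \<phi> \<psi>) = OrF (subst v n \<phi>) (subst v n \<psi>)"
| "subst v n (ImpF \<phi> \<psi>) = ImpF (subst v n \<phi>) (subst v n \<psi>)"
| "subst v n (IffF \<phi> \<psi>) = IffF (subst v n \<phi>) (subst v n \<psi>)"
| "subst v n (AllF w \<phi>) = AllF w (if w = v then \<phi> else subst v n \<phi>)"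
| "subst v n (ExF w \<phi>) = ExF w (if w = v then \<phi> else subst v n \<phi>)"

text \<open>The coefficient of \<open>X\<close>; meaningful for terms without unary symbols only.\<close>

primrec coeff :: "('f, 'c) trm \<Rightarrow> int" where
  "coeff (Var v) = (if v = X then 1 else 0)"
| "coeff (Num n) = 0"
| "coeff (Const c) = 0"
| "coeff (App f t) = 0"
| "coeff (Add t u) = coeff t + coeff u"
| "coeff (Sub t u) = coeff t - coeff u"
| "coeff (Uminus t) = - coeff t"
| "coeff (Mul k t) = k * coeff t"

text \<open>The formula \<open>F \<and> (\<forall>x. Q)\<close> belongs to the fragment.\<close>

definition fragment :: "('f, 'c) fm \<Rightarrow> ('f, 'c) fm \<Rightarrow> bool" where
  "fragment F Q \<longleftrightarrow>
     qfree F \<and> qfree Q \<and> free_vars F = {} \<and> free_vars Q \<subseteq> {X} \<and>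
     (\<forall>(f, t) \<in> set (apps F) \<union> set (apps Q). trm_apps t = []) \<and>
     (\<forall>(f, t) \<in> set (apps Q). coeff t \<noteq> 0) \<and>
     (\<forall>f t t'. (f, t) \<in> set (apps Q) \<longrightarrow> (f, t') \<in> set (apps Q) \<longrightarrow> coeff t = coeff t')"


section \<open>Semantics\<close>

text \<open>
  A total assignment of integers to cells is the same thing as an interpretation of all uninterpreted
  symbols.
\<close>

datatype ('f, 'c) cell = FCell 'f int | CCell 'c

type_synonym ('f, 'c) interp = "('f, 'c) cell \<Rightarrow> int"
type_synonym ('f, 'c) cell_interp = "('f, 'c) cell \<rightharpoonup> int"

primrec eval :: "('f, 'c) interp \<Rightarrow> (('f, 'c) var \<Rightarrow> int) \<Rightarrow> ('f, 'c) trm \<Rightarrow> int" where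
  "eval J e (Var v) = e v"
| "eval J e (Num n) = n"
| "eval J e (Const c) = J (CCell c)"
| "eval J e (App f t) = J (FCell f (eval J e t))"
| "eval J e (Add t u) = eval J e t + eval J e u"
| "eval J e (Sub t u) = eval J e t - eval J e u"
| "eval J e (Uminus t) = - eval J e t"
| "eval J e (Mul k t) = k * eval J e t"

primrec holds :: "('f, 'c) interp \<Rightarrow> (('f, 'c) var \<Rightarrow> int) \<Rightarrow> ('f, 'c) fm \<Rightarrow> bool" where
  "holds J e TrueF = True"
| "holds J e FalseF = False"
| "holds J e (EqF t u) = (eval J e t = eval J e u)"
| "holds J e (LeF t u) = (eval J e t \<le> eval J e u)"
| "holds J e (LtF t u) = (eval J e t < eval J e u)"
| "holds J e (DvdF k t) = (k dvd eval J e t)"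
| "holds J e (NotF \<phi>) = (\<not> holds J e \<phi>)"
| "holds J e (AndF \<phi> \<psi>) = (holds J e \<phi> \<and> holds J e \<psi>)"
| "holds J e (OrF \<phi> \<psi>) = (holds J e \<phi> \<or> holds J e \<psi>)"
| "holds J e (ImpF \<phi> \<psi>) = (holds J e \<phi> \<longrightarrow> holds J e \<psi>)"
| "holds J e (IffF \<phi> \<psi>) = (holds J e \<phi> \<longleftrightarrow> holds J e \<psi>)"
| "holds J e (AllF v \<phi>) = (\<forall>n. holds J (e(v := n)) \<phi>)"
| "holds J e (ExF v \<phi>) = (\<exists>n. holds J (e(v := n)) \<phi>)"

text \<open>The quantification over \<open>e\<close> is immaterial for sentences.\<close>

definition models :: "('f, 'c) interp \<Rightarrow> ('f, 'c) fm \<Rightarrow> bool" where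
  "models J \<phi> \<longleftrightarrow> (\<forall>e. holds J e \<phi>)"

definition satisfiable :: "('f, 'c) fm \<Rightarrow> bool" where
  "satisfiable \<phi> \<longleftrightarrow> (\<exists>J. models J \<phi>)"


section \<open>Satisfiability certificates\<close>

definition agrees :: "('f, 'c) cell_interp \<Rightarrow> ('f, 'c) interp \<Rightarrow> bool" where
  "agrees I J \<longleftrightarrow> (\<forall>c \<in> dom I. I c = Some (J c))"

text \<open>\<open>cell_eval I t = None\<close> is \<open>I(t) = \<bottom>\<close>.\<close>

definition cell_eval :: "('f, 'c) cell_interp \<Rightarrow> ('f, 'c) trm \<Rightarrow> int option" where
  "cell_eval I t =
     (if \<exists>n. \<forall>J e. agrees I J \<longrightarrow> eval J e t = n
      then Some (THE n. \<forall>J e. agrees I J \<longrightarrow> eval J e t = n) else None)"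

definition cell_models :: "('f, 'c) cell_interp \<Rightarrow> ('f, 'c) fm \<Rightarrow> bool" where
  "cell_models I \<phi> \<longleftrightarrow> (\<forall>J. agrees I J \<longrightarrow> models J \<phi>)"

definition pre_sat_certificate ::
    "('f, 'c) fm \<Rightarrow> ('f, 'c) fm \<Rightarrow> ('f, 'c) cell_interp \<Rightarrow> bool" where
  "pre_sat_certificate G P I \<longleftrightarrow>
     finite (dom I) \<and> cell_models I G \<and>
     (\<forall>z. \<forall>(f, t) \<in> set (apps P). cell_eval I (trm_subst X z t) \<noteq> None)"

definition relevant_cells ::
    "('f, 'c) fm \<Rightarrow> ('f, 'c) cell_interp \<Rightarrow> int \<Rightarrow> ('f, 'c) cell set" where
  "relevant_cells P I z =
     {FCell f n | f t n. (f, t) \<in> set (apps P) \<and> cell_eval I (trm_subst X z t) = Some n}"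

text \<open>
  \<open>R\<close> is the well-order \<open>\<preceq>\<close>; \<open>\<rho>\<close> and \<open>\<tau>\<close> are the values of the undefined relevant cells outside
  and inside \<open>Xs z\<close>.
\<close>

definition sat_certificate ::
    "('f, 'c) fm \<Rightarrow> ('f, 'c) fm \<Rightarrow> ('f, 'c) cell_interp \<Rightarrow> int rel \<Rightarrow>
     (int \<Rightarrow> ('f, 'c) cell set) \<Rightarrow> bool" where
  "sat_certificate G P I R Xs \<longleftrightarrow>
     pre_sat_certificate G P I \<and>
     well_order_on UNIV R \<and>
     (\<forall>z. Xs z \<subseteq> relevant_cells P I z \<and>
          Xs z \<inter> dom I = {} \<and>
          Xs z \<inter> (\<Union>z' \<in> {z'. (z', z) \<in> R \<and> z' \<noteq> z}. relevant_cells P I z') = {} \<and>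
          (\<forall>\<rho>. dom \<rho> = relevant_cells P I z - dom I - Xs z \<longrightarrow>
             (\<exists>\<tau>. dom \<tau> = Xs z \<and> cell_models (I ++ \<rho> ++ \<tau>) (subst X z P))))"

definition has_sat_certificate :: "('f, 'c) fm \<Rightarrow> bool" where
  "has_sat_certificate \<phi> \<longleftrightarrow>
     (\<exists>G P. \<phi> = AndF G (AllF X P) \<and>
        qfree G \<and> qfree P \<and> free_vars G = {} \<and> free_vars P \<subseteq> {X} \<and>
        (\<exists>I R Xs. sat_certificate G P I R Xs))"


section \<open>The conditions for certificate existence\<close>

datatype sign = SPos | SNeg

definition sign_mult :: "sign \<Rightarrow> sign \<Rightarrow> sign" where
  "sign_mult s s' = (if s = s' then SPos else SNeg)"

definition signed_lt :: "sign \<Rightarrow> ('f, 'c) trm \<Rightarrow> ('f, 'c) trm \<Rightarrow> ('f, 'c) fm" where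
  "signed_lt s t t' = (case s of SPos \<Rightarrow> LtF t t' | SNeg \<Rightarrow> LtF t' t)"

text \<open>In the fragment, all arguments of \<open>f\<close> in \<open>Q\<close> have the same nonzero coefficient.\<close>

definition sigma :: "('f, 'c) fm \<Rightarrow> 'f \<Rightarrow> sign" where
  "sigma Q f = (if \<exists>t. (f, t) \<in> set (apps Q) \<and> coeff t > 0 then SPos else SNeg)"

definition bound :: "sign \<Rightarrow> int \<Rightarrow> int \<Rightarrow> int" where
  "bound s bmin bmax = (case s of SPos \<Rightarrow> bmax | SNeg \<Rightarrow> bmin)"

definition outside :: "int \<Rightarrow> int \<Rightarrow> ('f, 'c) fm" where
  "outside bmin bmax = OrF (LtF (Var X) (Num bmin)) (LtF (Num bmax) (Var X))"

text \<open>
  The sets \<open>\<T>\<close> and \<open>\<F>\<close> as lists without repetition, so that \<open>subseqs (app_terms Q)\<close> enumerates the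
  subsets of \<open>\<T>\<close>.
\<close>

definition app_terms :: "('f, 'c) fm \<Rightarrow> ('f \<times> ('f, 'c) trm) list" where
  "app_terms Q = remdups (apps Q)"

definition fun_syms :: "('f, 'c) fm \<Rightarrow> 'f list" where
  "fun_syms Q = remdups (map fst (app_terms Q))"

definition rest :: "('f, 'c) fm \<Rightarrow> ('f \<times> ('f, 'c) trm) list \<Rightarrow> ('f \<times> ('f, 'c) trm) list" where
  "rest Q S = filter (\<lambda>a. a \<notin> set S) (app_terms Q)"

definition Phi_ext ::
    "('f, 'c) fm \<Rightarrow> sign \<Rightarrow> ('f \<times> ('f, 'c) trm) list \<Rightarrow> ('f, 'c) fm" where
  "Phi_ext Q s S =
     subst X 0 (conj_list
       [AndF
          (conj_list [EqF t t'. (g, t) \<leftarrow> S, g = f, (g', t') \<leftarrow> S, g' = f])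
          (conj_list [signed_lt (sign_mult (sigma Q f) s) t' t.
                        (g, t) \<leftarrow> S, g = f, (g', t') \<leftarrow> rest Q S, g' = f]).
        f \<leftarrow> fun_syms Q])"

text \<open>\<open>Q'(\<S>)\<close>: each \<open>f(t) \<in> \<S>\<close> becomes \<open>V f t\<close> and every other \<open>f(t)\<close> becomes \<open>U f t\<close>.\<close>

primrec trm_abstract ::
    "('f \<times> ('f, 'c) trm) list \<Rightarrow> ('f, 'c) trm \<Rightarrow> ('f, 'c) trm" where
  "trm_abstract S (Var v) = Var v"
| "trm_abstract S (Num n) = Num n"
| "trm_abstract S (Const c) = Const c"
| "trm_abstract S (App f t) = Var (if (f, t) \<in> set S then V f t else U f t)"
| "trm_abstract S (Add t u) = Add (trm_abstract S t) (trm_abstract S u)"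
| "trm_abstract S (Sub t u) = Sub (trm_abstract S t) (trm_abstract S u)"
| "trm_abstract S (Uminus t) = Uminus (trm_abstract S t)"
| "trm_abstract S (Mul k t) = Mul k (trm_abstract S t)"

primrec abstract :: "('f \<times> ('f, 'c) trm) list \<Rightarrow> ('f, 'c) fm \<Rightarrow> ('f, 'c) fm" where
  "abstract S TrueF = TrueF"
| "abstract S FalseF = FalseF"
| "abstract S (EqF t u) = EqF (trm_abstract S t) (trm_abstract S u)"
| "abstract S (LeF t u) = LeF (trm_abstract S t) (trm_abstract S u)"
| "abstract S (LtF t u) = LtF (trm_abstract S t) (trm_abstract S u)"
| "abstract S (DvdF k t) = DvdF k (trm_abstract S t)"
| "abstract S (NotF \<phi>) = NotF (abstract S \<phi>)"
| "abstract S (AndF \<phi> \<psi>) = AndF (abstract S \<phi>) (abstract S \<psi>)"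
| "abstract S (OrF \<phi> \<psi>) = OrF (abstract S \<phi>) (abstract S \<psi>)"
| "abstract S (ImpF \<phi> \<psi>) = ImpF (abstract S \<phi>) (abstract S \<psi>)"
| "abstract S (IffF \<phi> \<psi>) = IffF (abstract S \<phi>) (abstract S \<psi>)"
| "abstract S (AllF v \<phi>) = AllF v (abstract S \<phi>)"
| "abstract S (ExF v \<phi>) = ExF v (abstract S \<phi>)"

text \<open>
  The terms of \<open>\<S>\<close> with the same head symbol have equal arguments by \<open>Phi_ext\<close>, hence denote the same
  cell, so their variables must receive the same value.  \<open>congruence S\<close> expresses this; it is trivial
  if \<open>\<S>\<close> contains at most one term for each symbol.  Without it the conditions would be unsound: for
  \<open>F\<close> being \<open>c = d\<close> and \<open>Q\<close> being \<open>x = 0 \<or> (f(x + c) = 0 \<and> f(x + d) = 1)\<close>, they would all hold for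
  \<open>B = [0, 0]\<close> and \<open>\<S> = {f(x + c), f(x + d)}\<close>, but \<open>F \<and> (\<forall>x. Q)\<close> is unsatisfiable.
\<close>

definition congruence :: "('f \<times> ('f, 'c) trm) list \<Rightarrow> ('f, 'c) fm" where
  "congruence S =
     conj_list [EqF (Var (V f t)) (Var (V f' t')). (f, t) \<leftarrow> S, (f', t') \<leftarrow> S, f = f']"

definition Phi_prop :: "('f, 'c) fm \<Rightarrow> ('f \<times> ('f, 'c) trm) list \<Rightarrow> ('f, 'c) fm" where
  "Phi_prop Q S =
     AllF X (foldr AllF [U f t. (f, t) \<leftarrow> rest Q S]
       (foldr ExF [V f t. (f, t) \<leftarrow> S] (AndF (congruence S) (abstract S Q))))"

definition Psi ::
    "('f, 'c) fm \<Rightarrow> ('f, 'c) fm \<Rightarrow> sign \<Rightarrow> int \<Rightarrow> int \<Rightarrow> ('f \<times> ('f, 'c) trm) list \<Rightarrow>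
     ('f, 'c) fm" where
  "Psi F Q s bmin bmax S =
     AndF (Phi_ext Q s S) (AndF (Phi_prop Q S)
       (conj_list [signed_lt (sign_mult (sigma Q f) s) a (trm_subst X (bound s bmin bmax) t).
                     (f, t) \<leftarrow> S, a \<leftarrow> args F f]))"

definition instances :: "('f, 'c) fm \<Rightarrow> int \<Rightarrow> int \<Rightarrow> ('f, 'c) fm" where
  "instances Q bmin bmax = conj_list [subst X z Q. z \<leftarrow> [bmin..bmax]]"

end

theory Submission
  imports Defs
begin

text \<open>
  Fix a model of the hypothesis and let \<open>I\<close> be its restriction to the finitely many cells needed to
  evaluate \<open>F\<close> and the instances of \<open>Q\<close> in \<open>B\<close>.  Enumerate the integers starting with \<open>b\<^sub>m\<^sub>i\<^sub>n\<close> so that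
  those above \<open>B\<close> ascend and those below \<open>B\<close> descend.  Above \<open>B\<close> let \<open>X\<^sub>z\<close> consist of the cells of
  the terms in \<open>\<S>\<close>, below \<open>B\<close> of those in \<open>\<S>'\<close>.  As the terms in \<open>\<S>\<close> are extremal, their argument
  values at \<open>z\<close> lie strictly beyond all argument values at earlier integers, and beyond those of \<open>F\<close>;
  so these cells are fresh, and the propagability condition yields values for them.
\<close>

section \<open>Evaluation\<close>

lemma eval_trm_subst: "eval J e (trm_subst v n t) = eval J (e(v := n)) t"
  by (induction t) auto

lemma holds_subst: "holds J e (subst v n \<phi>) \<longleftrightarrow> holds J (e(v := n)) \<phi>"
  by (induction \<phi> arbitrary: e) (auto simp: eval_trm_subst fun_upd_twist)

lemma trm_vars_trm_subst: "trm_vars (trm_subst v n t) = trm_vars t - {v}"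
  by (induction t) auto

lemma free_vars_subst: "free_vars (subst v n \<phi>) = free_vars \<phi> - {v}"
  by (induction \<phi>) (auto simp: trm_vars_trm_subst)

lemma qfree_subst: "qfree (subst v n \<phi>) = qfree \<phi>"
  by (induction \<phi>) auto

lemma holds_conj_list: "holds J e (conj_list \<phi>s) \<longleftrightarrow> (\<forall>\<phi> \<in> set \<phi>s. holds J e \<phi>)"
  by (induction \<phi>s) auto

lemma holds_disj_list: "holds J e (disj_list \<phi>s) \<longleftrightarrow> (\<exists>\<phi> \<in> set \<phi>s. holds J e \<phi>)"
  by (induction \<phi>s) auto

lemma qfree_conj_list: "qfree (conj_list \<phi>s) \<longleftrightarrow> (\<forall>\<phi> \<in> set \<phi>s. qfree \<phi>)"
  by (induction \<phi>s) auto

lemma free_vars_conj_list: "free_vars (conj_list \<phi>s) = (\<Union>\<phi> \<in> set \<phi>s. free_vars \<phi>)"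
  by (induction \<phi>s) auto

text \<open>Collapses a quantifier block into one choice of an environment, so that all
  \<open>u\<close> variables can be instantiated at once.\<close>

lemma holds_foldr_AllF:
  "holds J e (foldr AllF vs \<phi>) \<longleftrightarrow> (\<forall>e'. (\<forall>v. v \<notin> set vs \<longrightarrow> e' v = e v) \<longrightarrow> holds J e' \<phi>)"
proof (induction vs arbitrary: e)
  case Nil
  have "e' = e" if "\<forall>v. e' v = e v" for e' using that by auto
  then show ?case by auto
next
  case (Cons a vs)
  show ?case
  proof
    assume L: "holds J e (foldr AllF (a # vs) \<phi>)"
    show "\<forall>e'. (\<forall>v. v \<notin> set (a # vs) \<longrightarrow> e' v = e v) \<longrightarrow> holds J e' \<phi>"
    proof (intro allI impI)
      fix e' assume e': "\<forall>v. v \<notin> set (a # vs) \<longrightarrow> e' v = e v"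
      have "holds J (e(a := e' a)) (foldr AllF vs \<phi>)" using L by simp
      then show "holds J e' \<phi>" using e' unfolding Cons.IH by auto
    qed
  next
    assume R: "\<forall>e'. (\<forall>v. v \<notin> set (a # vs) \<longrightarrow> e' v = e v) \<longrightarrow> holds J e' \<phi>"
    have "holds J (e(a := n)) (foldr AllF vs \<phi>)" for n
      unfolding Cons.IH using R by auto
    then show "holds J e (foldr AllF (a # vs) \<phi>)" by simp
  qed
qed

lemma holds_foldr_ExF:
  "holds J e (foldr ExF vs \<phi>) \<longleftrightarrow> (\<exists>e'. (\<forall>v. v \<notin> set vs \<longrightarrow> e' v = e v) \<and> holds J e' \<phi>)"
proof -
  have "holds J e (foldr ExF vs \<phi>) \<longleftrightarrow> \<not> holds J e (foldr AllF vs (NotF \<phi>))"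
    by (induction vs arbitrary: e) auto
  then show ?thesis by (auto simp: holds_foldr_AllF)
qed

section \<open>Cells read by an evaluation\<close>

primrec trm_cells :: "('f, 'c) interp \<Rightarrow> (('f, 'c) var \<Rightarrow> int) \<Rightarrow> ('f, 'c) trm \<Rightarrow> ('f, 'c) cell set" where
  "trm_cells J e (Var v) = {}"
| "trm_cells J e (Num n) = {}"
| "trm_cells J e (Const c) = {CCell c}"
| "trm_cells J e (App f t) = insert (FCell f (eval J e t)) (trm_cells J e t)"
| "trm_cells J e (Add t u) = trm_cells J e t \<union> trm_cells J e u"
| "trm_cells J e (Sub t u) = trm_cells J e t \<union> trm_cells J e u"
| "trm_cells J e (Uminus t) = trm_cells J e t"
| "trm_cells J e (Mul k t) = trm_cells J e t"

text \<open>Meaningful for quantifier-free formulas only.\<close>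

primrec fm_cells :: "('f, 'c) interp \<Rightarrow> (('f, 'c) var \<Rightarrow> int) \<Rightarrow> ('f, 'c) fm \<Rightarrow> ('f, 'c) cell set" where
  "fm_cells J e TrueF = {}"
| "fm_cells J e FalseF = {}"
| "fm_cells J e (EqF t u) = trm_cells J e t \<union> trm_cells J e u"
| "fm_cells J e (LeF t u) = trm_cells J e t \<union> trm_cells J e u"
| "fm_cells J e (LtF t u) = trm_cells J e t \<union> trm_cells J e u"
| "fm_cells J e (DvdF k t) = trm_cells J e t"
| "fm_cells J e (NotF \<phi>) = fm_cells J e \<phi>"
| "fm_cells J e (AndF \<phi> \<psi>) = fm_cells J e \<phi> \<union> fm_cells J e \<psi>"
| "fm_cells J e (OrF \<phi> \<psi>) = fm_cells J e \<phi> \<union> fm_cells J e \<psi>"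
| "fm_cells J e (ImpF \<phi> \<psi>) = fm_cells J e \<phi> \<union> fm_cells J e \<psi>"
| "fm_cells J e (IffF \<phi> \<psi>) = fm_cells J e \<phi> \<union> fm_cells J e \<psi>"
| "fm_cells J e (AllF v \<phi>) = fm_cells J e \<phi>"
| "fm_cells J e (ExF v \<phi>) = fm_cells J e \<phi>"

lemma finite_trm_cells: "finite (trm_cells J e t)"
  by (induction t) auto

lemma finite_fm_cells: "finite (fm_cells J e \<phi>)"
  by (induction \<phi>) (auto simp: finite_trm_cells)

text \<open>Evaluation consults \<open>J\<close> only at the cells collected in
  \<open>trm_cells\<close>; once these agree, so do the arguments of nested symbols, and the same
  cells are read under \<open>J'\<close>.\<close>

lemma eval_cong:
  assumes "\<forall>c \<in> trm_cells J e t. J' c = J c" "\<forall>v \<in> trm_vars t. e' v = e v"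
  shows "eval J' e' t = eval J e t"
  using assms by (induction t) auto

lemma holds_cong:
  assumes "qfree \<phi>" "\<forall>c \<in> fm_cells J e \<phi>. J' c = J c" "\<forall>v \<in> free_vars \<phi>. e' v = e v"
  shows "holds J' e' \<phi> \<longleftrightarrow> holds J e \<phi>"
  using assms by (induction \<phi>) (simp_all add: ball_Un eval_cong[of J e _ J' e'])

lemma FCell_trm_cells:
  "FCell f n \<in> trm_cells J e t \<longleftrightarrow> (\<exists>u. (f, u) \<in> set (trm_apps t) \<and> n = eval J e u)"
  by (induction t) auto

lemma FCell_fm_cells:
  "FCell f n \<in> fm_cells J e \<phi> \<longleftrightarrow> (\<exists>u. (f, u) \<in> set (apps \<phi>) \<and> n = eval J e u)"
  by (induction \<phi>) (auto simp: FCell_trm_cells)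

lemma trm_cells_mono:
  assumes "(f, u) \<in> set (trm_apps t)" shows "trm_cells J e u \<subseteq> trm_cells J e t"
  using assms by (induction t) auto

lemma fm_cells_mono:
  assumes "(f, u) \<in> set (apps \<phi>)" shows "trm_cells J e u \<subseteq> fm_cells J e \<phi>"
  using assms by (induction \<phi>) (auto dest: trm_cells_mono)

lemma trm_vars_mono:
  assumes "(f, u) \<in> set (trm_apps t)" shows "trm_vars u \<subseteq> trm_vars t"
  using assms by (induction t) auto

lemma free_vars_mono:
  assumes "(f, u) \<in> set (apps \<phi>)" "qfree \<phi>" shows "trm_vars u \<subseteq> free_vars \<phi>"
  using assms by (induction \<phi>) (auto dest: trm_vars_mono)

text \<open>Which constants are read is a syntactic matter, whereas the unary cells vary with the
  values of the arguments.\<close>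

lemma CCell_trm_cells: "CCell c \<in> trm_cells J e t \<longleftrightarrow> CCell c \<in> trm_cells J' e' t"
  by (induction t) auto

lemma eval_coeff:
  assumes "trm_apps t = []"
  shows "eval J (e(X := n)) t = coeff t * n + eval J (e(X := 0)) t"
  using assms by (induction t) (auto simp: algebra_simps)

text \<open>Links abstraction to cells: \<open>J'\<close> stores in the cell of each
  \<open>f(u)\<close> the value that \<open>e\<close> gives to the variable standing for
  \<open>f(u)\<close>. \<open>J0\<close> and \<open>e0\<close> serve only to name the set of
  constants in \<open>t\<close>.\<close>

lemma eval_trm_abstract:
  assumes "\<forall>c. CCell c \<in> trm_cells J0 e0 t \<longrightarrow> J' (CCell c) = J (CCell c)"
    and "trm_vars t \<subseteq> {X}" and "e X = e' X"
    and "\<forall>(f, u) \<in> set (trm_apps t).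
           J' (FCell f (eval J' e' u)) = e (if (f, u) \<in> set S then V f u else U f u)"
  shows "eval J e (trm_abstract S t) = eval J' e' t"
  using assms by (induction t) auto

lemma holds_abstract:
  assumes "qfree \<phi>" "\<forall>c. CCell c \<in> fm_cells J0 e0 \<phi> \<longrightarrow> J' (CCell c) = J (CCell c)"
    and "free_vars \<phi> \<subseteq> {X}" and "e X = e' X"
    and "\<forall>(f, u) \<in> set (apps \<phi>).
           J' (FCell f (eval J' e' u)) = e (if (f, u) \<in> set S then V f u else U f u)"
  shows "holds J e (abstract S \<phi>) \<longleftrightarrow> holds J' e' \<phi>"
  using assms by (induction \<phi>) (simp_all add: eval_trm_abstract[of J0 e0 _ J' J e e' S])

section \<open>Soundness of certificates\<close>

lemma cell_eval_eqI:
  assumes "agrees I J" "\<And>J' e'. agrees I J' \<Longrightarrow> eval J' e' t = n"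
  shows "cell_eval I t = Some n"
proof -
  have "(THE m. \<forall>J e. agrees I J \<longrightarrow> eval J e t = m) = n"
    using assms by (intro the_equality) auto
  then show ?thesis using assms(2) unfolding cell_eval_def by auto
qed

text \<open>Cells are filled by recursion along the well-order: stage \<open>z\<close> keeps all
  earlier values and lets the witness choose those in \<open>Xs z\<close>. Freshness ensures that no
  cell is chosen twice or chosen after it was needed, so the choices glue to one
  interpretation.\<close>

lemma sat_certificate_sound:
  fixes G P :: "('f, 'c) fm"
  assumes "sat_certificate G P I R Xs"
  obtains J where "models J (AndF G (AllF X P))"
proof -
  define \<Gamma> where "\<Gamma> = relevant_cells P I"
  have G: "cell_models I G"
    using assms by (simp add: sat_certificate_def pre_sat_certificate_def)
  have wo: "well_order_on UNIV R" using assms by (simp add: sat_certificate_def)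
  then have wf: "wf (R - Id)" by (simp add: well_order_on_def)
  have lin: "(z, z') \<in> R \<or> (z', z) \<in> R" if "z \<noteq> z'" for z z'
    using wo that
    by (auto simp: well_order_on_def linear_order_on_def total_on_def)
  have Xs: "Xs z \<subseteq> \<Gamma> z" "Xs z \<inter> dom I = {}" for z
    using assms by (auto simp: sat_certificate_def \<Gamma>_def)
  have fresh: "Xs z \<inter> \<Gamma> z' = {}" if "(z', z) \<in> R - Id" for z z'
    using assms that unfolding sat_certificate_def \<Gamma>_def by blast
  have ext: "\<exists>\<tau>. dom \<tau> = Xs z \<and> cell_models (I ++ \<rho> ++ \<tau>) (subst X z P)"
    if "dom \<rho> = \<Gamma> z - dom I - Xs z" for z \<rho>
    using assms that unfolding sat_certificate_def \<Gamma>_def by blast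
  have uniq: "z = z'" if "c \<in> Xs z" "c \<in> Xs z'" for c z z'
  proof (rule ccontr)
    assume "z \<noteq> z'"
    then have "(z, z') \<in> R - Id \<or> (z', z) \<in> R - Id" using lin by auto
    then show False using fresh[of z z'] fresh[of z' z] Xs(1) that by blast
  qed
  \<comment> \<open>A relevant cell outside \<open>Xs z\<close> inherits the value chosen by the
    earlier stage that owns it; a cell without such an owner gets 0.\<close>
  define \<rho> :: "(int \<Rightarrow> ('f, 'c) cell_interp) \<Rightarrow> int \<Rightarrow> ('f, 'c) cell_interp" where
    "\<rho> f z c =
      (if c \<in> \<Gamma> z - dom I - Xs z
       then Some (if \<exists>z'. (z', z) \<in> R - Id \<and> c \<in> Xs z'
                  then the (f (SOME z'. (z', z) \<in> R - Id \<and> c \<in> Xs z') c) else 0)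
       else None)" for f z c
  have dom_\<rho>: "dom (\<rho> f z) = \<Gamma> z - dom I - Xs z" for f z
    by (auto simp: \<rho>_def dom_def)
  define Ok where "Ok f z \<tau> \<longleftrightarrow>
    dom \<tau> = Xs z \<and> cell_models (I ++ \<rho> f z ++ \<tau>) (subst X z P)"
    for f :: "int \<Rightarrow> ('f, 'c) cell_interp" and z \<tau>
  \<comment> \<open>Well-founded choice applies because \<open>\<rho> f z\<close> consults
    \<open>f\<close> only at strict predecessors of \<open>z\<close>.\<close>
  have "\<exists>f. \<forall>z. Ok f z (f z)"
  proof (rule dependent_wf_choice[OF wf])
    fix \<tau> z and f g :: "int \<Rightarrow> ('f, 'c) cell_interp"
    assume eq: "\<And>z'. (z', z) \<in> R - Id \<Longrightarrow> f z' = g z'"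
    have "\<rho> f z c = \<rho> g z c" for c
    proof (cases "\<exists>z'. (z', z) \<in> R - Id \<and> c \<in> Xs z'")
      case True
      have "f (SOME z'. (z', z) \<in> R - Id \<and> c \<in> Xs z') = g (SOME z'. (z', z) \<in> R - Id \<and> c \<in> Xs z')"
        using someI_ex[OF True] by (blast intro: eq)
      then show ?thesis by (simp only: \<rho>_def)
    qed (simp only: \<rho>_def if_False)
    then have "\<rho> f z = \<rho> g z" by auto
    then show "Ok f z \<tau> = Ok g z \<tau>" by (simp add: Ok_def)
  next
    fix f z
    show "\<exists>\<tau>. Ok f z \<tau>" using ext[OF dom_\<rho>] by (auto simp: Ok_def)
  qed
  then obtain f where f: "\<And>z. Ok f z (f z)" by blast
  \<comment> \<open>By \<open>uniq\<close> the owner of a cell is unique. The default 0 has to match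
    the one in \<open>\<rho>\<close>.\<close>
  define J where "J c =
    (if c \<in> dom I then the (I c)
     else if \<exists>z. c \<in> Xs z then the (f (THE z. c \<in> Xs z) c) else 0)" for c
  have J_Xs: "f z c = Some (J c)" if "c \<in> Xs z" for z c
  proof -
    have "(THE z. c \<in> Xs z) = z" using that uniq by blast
    moreover have "c \<in> dom (f z)" using f[of z] that by (simp add: Ok_def)
    moreover have "c \<notin> dom I" using Xs that by blast
    ultimately show ?thesis using that by (auto simp: J_def)
  qed
  have J_\<rho>: "\<rho> f z c = Some (J c)" if c: "c \<in> \<Gamma> z - dom I - Xs z" for z c
  proof (cases "\<exists>z'. (z', z) \<in> R - Id \<and> c \<in> Xs z'")
    case True
    have "f (SOME z'. (z', z) \<in> R - Id \<and> c \<in> Xs z') c = Some (J c)"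
      using someI_ex[OF True] by (blast intro: J_Xs)
    then show ?thesis using c True by (simp only: \<rho>_def if_True option.sel)
  next
    case False
    \<comment> \<open>No earlier stage owns \<open>c\<close> in this case, and a later one cannot,
      since \<open>c\<close> is already relevant at \<open>z\<close>; hence both defaults
      apply.\<close>
    have "c \<notin> Xs z'" for z'
    proof
      assume z': "c \<in> Xs z'"
      then have "z' \<noteq> z" using c by auto
      then have "(z, z') \<in> R - Id" using False lin z' by auto
      then show False using fresh z' c by blast
    qed
    then show ?thesis using c False by (auto simp: \<rho>_def J_def)
  qed
  have "agrees I J" by (auto simp: agrees_def J_def)
  then have "models J G" using G by (simp add: cell_models_def)
  moreover have "models J (subst X z P)" for z
  proof -
    have "agrees (I ++ \<rho> f z ++ f z) J"
      unfolding agrees_def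
    proof
      fix c assume c: "c \<in> dom (I ++ \<rho> f z ++ f z)"
      have dom_f: "dom (f z) = Xs z" using f[of z] by (simp add: Ok_def)
      show "(I ++ \<rho> f z ++ f z) c = Some (J c)"
      proof (cases "c \<in> Xs z")
        case True
        then show ?thesis using J_Xs by (simp add: map_add_Some_iff)
      next
        case False
        then have nf: "f z c = None" using dom_f by auto
        show ?thesis
        proof (cases "c \<in> dom (\<rho> f z)")
          case True
          then show ?thesis using nf J_\<rho> dom_\<rho> by (simp add: map_add_def)
        next
          case False
          then show ?thesis using nf c by (auto simp: map_add_def J_def split: option.splits)
        qed
      qed
    qed
    then show ?thesis using f[of z] by (auto simp: Ok_def cell_models_def)
  qed
  ultimately have "models J (AndF G (AllF X P))"
    by (auto simp: models_def holds_subst)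
  then show ?thesis by (rule that)
qed

section \<open>Extremality and propagability\<close>

text \<open>Multiplying by this factor turns the signed order into the usual one and products of
  signs into products of integers, so that arithmetic replaces case splits.\<close>

primrec sign_val :: "sign \<Rightarrow> int" where
  "sign_val SPos = 1"
| "sign_val SNeg = -1"

lemma holds_signed_lt:
  "holds J e (signed_lt s t t') \<longleftrightarrow> sign_val s * eval J e t < sign_val s * eval J e t'"
  by (cases s) (auto simp: signed_lt_def)

lemma sign_val_mult: "sign_val (sign_mult s s') = sign_val s * sign_val s'"
  by (cases s; cases s') (auto simp: sign_mult_def)

lemma fragmentD:
  assumes "fragment F Q"
  shows "qfree F" "qfree Q" "free_vars F = {}" "free_vars Q \<subseteq> {X}"
    and "(f, t) \<in> set (apps Q) \<Longrightarrow> trm_apps t = []"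
    and "(f, t) \<in> set (apps Q) \<Longrightarrow> coeff t \<noteq> 0"
    and "(f, t) \<in> set (apps Q) \<Longrightarrow> (f, t') \<in> set (apps Q) \<Longrightarrow> coeff t = coeff t'"
  using assms unfolding fragment_def by blast+

text \<open>All arguments of \<open>f\<close> in \<open>Q\<close> share one nonzero coefficient, so
  the existence test in \<open>sigma\<close> determines the sign of each of them.\<close>

lemma sign_val_sigma:
  assumes "fragment F Q" "(f, t) \<in> set (apps Q)"
  shows "sign_val (sigma Q f) * coeff t > 0"
proof -
  have "coeff t > 0 \<longleftrightarrow> (\<exists>t'. (f, t') \<in> set (apps Q) \<and> coeff t' > 0)"
    using fragmentD(7)[OF assms(1), of f] assms(2) by metis
  then show ?thesis using fragmentD(6)[OF assms] by (auto simp: sigma_def)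
qed

lemma set_rest: "set (rest Q S) = set (apps Q) - set S"
  by (auto simp: rest_def app_terms_def)

lemma set_args: "set (args \<phi> f) = {t. (f, t) \<in> set (apps \<phi>)}"
  by (auto simp: args_def)

lemma set_fun_syms: "set (fun_syms Q) = fst ` set (apps Q)"
  by (auto simp: fun_syms_def app_terms_def)

lemma in_concat_mapI:
  assumes "y \<in> set (f x)" "x \<in> set xs" shows "y \<in> set (concat (map f xs))"
  using assms by auto

text \<open>The constant environment \<open>\<lambda>_. z\<close> stands for \<open>x = z\<close>
  throughout, which is harmless because \<open>X\<close> is the only variable of the
  fragment.\<close>

lemma upd_const: "(\<lambda>_. z)(v := z) = (\<lambda>_. z)"
  by auto

text \<open>Treats both sides of the interval at once: \<open>s = SPos\<close> serves the integers
  above \<open>bmax\<close>, \<open>s = SNeg\<close> those below \<open>bmin\<close>.\<close>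

locale extremal =
  fixes F Q :: "('f, 'c) fm" and bmin bmax :: int and J :: "('f, 'c) interp"
    and s :: sign and S :: "('f \<times> ('f, 'c) trm) list"
  assumes fragment: "fragment F Q"
    and S_apps: "set S \<subseteq> set (apps Q)"
    and Psi: "holds J (\<lambda>_. 0) (Psi F Q s bmin bmax S)"
begin

text \<open>Scaled by \<open>key f\<close>, the arguments of \<open>f\<close> in \<open>Q\<close>
  increase as \<open>x\<close> moves in direction \<open>s\<close>.\<close>

definition key :: "'f \<Rightarrow> int" where
  "key f = sign_val (sigma Q f) * sign_val s"

lemma eval_apps:
  assumes "(f, t) \<in> set (apps Q)"
  shows "eval J (\<lambda>_. z) t = coeff t * z + eval J (\<lambda>_. 0) t"
proof -
  have flat: "trm_apps t = []" "trm_vars t \<subseteq> {X}"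
    using fragmentD[OF fragment] free_vars_mono[OF assms] assms by blast+
  have "eval J (\<lambda>_. z) t = eval J ((\<lambda>_. 0)(X := z)) t"
    using flat by (intro eval_cong) auto
  then show ?thesis using eval_coeff[OF flat(1), of J "\<lambda>_. 0" z] by (simp add: upd_const)
qed

lemma coeff_eq:
  assumes "(f, t) \<in> set (apps Q)" "(f, t') \<in> set (apps Q)"
  shows "coeff t = coeff t'"
  using fragmentD(7)[OF fragment assms] .

lemma ext_eq_0:
  assumes "(f, t) \<in> set S" "(f, t') \<in> set S"
  shows "eval J (\<lambda>_. 0) t = eval J (\<lambda>_. 0) t'"
proof -
  let ?\<phi>s = "[EqF t t'. (g, t) \<leftarrow> S, g = f, (g', t') \<leftarrow> S, g' = f]"
  have "f \<in> set (fun_syms Q)" using assms S_apps by (force simp: set_fun_syms)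
  then have "holds J (\<lambda>_. 0) (conj_list ?\<phi>s)"
    using Psi by (auto simp: Psi_def Phi_ext_def holds_subst holds_conj_list upd_const)
  then have "holds J (\<lambda>_. 0) (EqF t t')"
    unfolding holds_conj_list
  proof (rule bspec)
    show "EqF t t' \<in> set ?\<phi>s"
      by (rule in_concat_mapI[where x = "(f, t)"], simp only: prod.case simp_thms if_True,
          rule in_concat_mapI[where x = "(f, t')"]) (use assms in simp_all)
  qed
  then show ?thesis by simp
qed

lemma ext_less_0:
  assumes "(f, t) \<in> set S" "(f, t') \<in> set (apps Q) - set S"
  shows "key f * eval J (\<lambda>_. 0) t' < key f * eval J (\<lambda>_. 0) t"
proof -
  let ?\<phi>s = "[signed_lt (sign_mult (sigma Q f) s) t' t.
      (g, t) \<leftarrow> S, g = f, (g', t') \<leftarrow> rest Q S, g' = f]"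
  have "f \<in> set (fun_syms Q)" using assms S_apps by (force simp: set_fun_syms)
  then have "holds J (\<lambda>_. 0) (conj_list ?\<phi>s)"
    using Psi by (auto simp: Psi_def Phi_ext_def holds_subst holds_conj_list upd_const)
  then have "holds J (\<lambda>_. 0) (signed_lt (sign_mult (sigma Q f) s) t' t)"
    unfolding holds_conj_list
  proof (rule bspec)
    show "signed_lt (sign_mult (sigma Q f) s) t' t \<in> set ?\<phi>s"
      by (rule in_concat_mapI[where x = "(f, t)"], simp only: prod.case simp_thms if_True,
          rule in_concat_mapI[where x = "(f, t')"]) (use assms in \<open>simp_all add: set_rest\<close>)
  qed
  then show ?thesis by (simp add: holds_signed_lt sign_val_mult key_def)
qed

text \<open>With equal coefficients the difference of two arguments does not depend on
  \<open>x\<close>, so the strict inequality at 0 separates them everywhere.\<close>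

lemma ext_neq:
  assumes "(f, t) \<in> set S" "(f, t') \<in> set (apps Q) - set S"
  shows "eval J (\<lambda>_. z) t \<noteq> eval J (\<lambda>_. z) t'"
proof -
  have *: "(f, t) \<in> set (apps Q)" "(f, t') \<in> set (apps Q)" using assms S_apps by auto
  show ?thesis
    unfolding eval_apps[OF *(1), of z] eval_apps[OF *(2), of z] coeff_eq[OF *]
    using ext_less_0[OF assms] by auto
qed

text \<open>Two effects add up: at 0 the argument \<open>t\<close> is already at least as far out as
  \<open>t'\<close>, and moving from \<open>z'\<close> to \<open>z\<close> adds a positive multiple
  of the distance.\<close>

lemma ext_less:
  assumes t: "(f, t) \<in> set S" and t': "(f, t') \<in> set (apps Q)"
    and z: "sign_val s * z' < sign_val s * z"
  shows "key f * eval J (\<lambda>_. z') t' < key f * eval J (\<lambda>_. z) t"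
proof -
  have t_apps: "(f, t) \<in> set (apps Q)" using t S_apps by blast
  have "key f * eval J (\<lambda>_. 0) t' \<le> key f * eval J (\<lambda>_. 0) t"
    using ext_less_0[OF t, of t'] ext_eq_0[OF t, of t'] t' by force
  moreover have "(sign_val (sigma Q f) * coeff t) * (sign_val s * z')
      < (sign_val (sigma Q f) * coeff t) * (sign_val s * z)"
    using sign_val_sigma[OF fragment t_apps] z by (rule mult_strict_left_mono[rotated])
  ultimately show ?thesis
    unfolding eval_apps[OF t', of z'] eval_apps[OF t_apps, of z] coeff_eq[OF t' t_apps] key_def
    by (simp add: algebra_simps)
qed

text \<open>By \<open>Psi\<close> the argument \<open>t\<close> exceeds those of \<open>F\<close> at
  the end of the interval, and beyond that end it moves further out.\<close>

lemma ext_F: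
  assumes t: "(f, t) \<in> set S" and a: "(f, a) \<in> set (apps F)"
    and z: "sign_val s * bound s bmin bmax < sign_val s * z"
  shows "key f * eval J (\<lambda>_. 0) a < key f * eval J (\<lambda>_. z) t"
proof -
  have t_apps: "(f, t) \<in> set (apps Q)" using t S_apps by blast
  have vars: "trm_vars t \<subseteq> {X}"
    using fragmentD(2,4)[OF fragment] free_vars_mono[OF t_apps] by blast
  let ?b = "bound s bmin bmax"
  have "holds J (\<lambda>_. 0) (conj_list
      [signed_lt (sign_mult (sigma Q f) s) a (trm_subst X ?b t). (f, t) \<leftarrow> S, a \<leftarrow> args F f])"
    using Psi by (simp add: Psi_def)
  then have "holds J (\<lambda>_. 0) (signed_lt (sign_mult (sigma Q f) s) a (trm_subst X ?b t))"
    unfolding holds_conj_list by (rule bspec) (use t a in \<open>force simp: set_args\<close>)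
  then have "key f * eval J (\<lambda>_. 0) a < key f * eval J ((\<lambda>_. 0)(X := ?b)) t"
    by (simp add: holds_signed_lt sign_val_mult key_def eval_trm_subst)
  also have "eval J ((\<lambda>_. 0)(X := ?b)) t = eval J (\<lambda>_. ?b) t"
    using vars by (intro eval_cong) auto
  also have "key f * eval J (\<lambda>_. ?b) t < key f * eval J (\<lambda>_. z) t"
    using ext_less[OF t t_apps z] .
  finally show ?thesis .
qed

text \<open>These cells become the set \<open>Xs z\<close> on the side of the interval given by
  \<open>s\<close>.\<close>

definition new_cells :: "int \<Rightarrow> ('f, 'c) cell set" where
  "new_cells z = {FCell f (eval J (\<lambda>_. z) t) | f t. (f, t) \<in> set S}"

lemma rest_not_new:
  assumes "(f, t) \<in> set (apps Q) - set S"
  shows "FCell f (eval J (\<lambda>_. z) t) \<notin> new_cells z"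
proof
  assume "FCell f (eval J (\<lambda>_. z) t) \<in> new_cells z"
  then obtain t' where "(f, t') \<in> set S" "eval J (\<lambda>_. z) t = eval J (\<lambda>_. z) t'"
    unfolding new_cells_def by blast
  then show False using ext_neq[OF _ assms, of t' z] by metis
qed

text \<open>\<open>K\<close> fixes the \<open>u\<close> values, the propagability condition yields
  the \<open>v\<close> values, and these are written into the cells of \<open>S\<close>. No conflict
  arises: \<open>congruence\<close> covers two terms of \<open>S\<close> sharing a cell,
  \<open>rest_not_new\<close> separates \<open>S\<close> from the rest, and terms of the rest
  sharing a cell read the same entry of \<open>K\<close>.\<close>

lemma propagate:
  fixes z :: int and K :: "('f, 'c) cell_interp"
  assumes const: "\<And>c. CCell c \<in> fm_cells J (\<lambda>_. z) Q \<Longrightarrow> K (CCell c) = Some (J (CCell c))"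
    and cells: "\<And>f t. (f, t) \<in> set (apps Q) - set S \<Longrightarrow> FCell f (eval J (\<lambda>_. z) t) \<in> dom K"
  obtains \<tau> where "dom \<tau> = new_cells z" "cell_models (K ++ \<tau>) (subst X z Q)"
proof -
  have Q: "qfree Q" "free_vars Q \<subseteq> {X}" using fragmentD[OF fragment] by blast+
  let ?us = "[U f t. (f, t) \<leftarrow> rest Q S]" and ?vs = "[V f t. (f, t) \<leftarrow> S]"
  \<comment> \<open>The instance of the universal block: \<open>X\<close> is \<open>z\<close> and
    each \<open>u\<close> variable takes the value that \<open>K\<close> stores for its
    cell.\<close>
  define e1 where "e1 v = (if v \<in> set ?us
    then (case v of U f t \<Rightarrow> the (K (FCell f (eval J (\<lambda>_. z) t))) | _ \<Rightarrow> 0)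
    else ((\<lambda>_. 0)(X := z)) v)" for v
  have "holds J (\<lambda>_. 0) (Phi_prop Q S)" using Psi by (simp add: Psi_def)
  then have "holds J ((\<lambda>_. 0)(X := z))
      (foldr AllF ?us (foldr ExF ?vs (AndF (congruence S) (abstract S Q))))"
    unfolding Phi_prop_def by (simp only: holds.simps)
  then have "holds J e1 (foldr ExF ?vs (AndF (congruence S) (abstract S Q)))"
    unfolding holds_foldr_AllF by (rule allE[of _ e1]) (simp add: e1_def)
  then obtain e2 where e2: "\<And>v. v \<notin> set ?vs \<Longrightarrow> e2 v = e1 v"
    and congr: "holds J e2 (congruence S)" and abs: "holds J e2 (abstract S Q)"
    unfolding holds_foldr_ExF by auto
  have U_V: "X \<notin> set ?us" "X \<notin> set ?vs" "U f t \<notin> set ?vs" for f t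
    by (auto split: prod.splits)
  have e2_X: "e2 X = z" using e2[OF U_V(2)] U_V(1) by (simp only: e1_def fun_upd_same if_False)
  have e2_U: "e2 (U f t) = the (K (FCell f (eval J (\<lambda>_. z) t)))"
    if "(f, t) \<in> set (apps Q) - set S" for f t
  proof -
    have "U f t \<in> set ?us" using that by (force simp: set_rest)
    then show ?thesis using e2[OF U_V(3)] by (simp only: e1_def if_True var.case)
  qed
  have e2_V: "e2 (V f t) = e2 (V f t')" if "(f, t) \<in> set S" "(f, t') \<in> set S" for f t t'
  proof -
    have "holds J e2 (EqF (Var (V f t)) (Var (V f t')))"
      using congr unfolding congruence_def holds_conj_list by (rule bspec) (use that in force)
    then show ?thesis by simp
  qed
  \<comment> \<open>A cell does not record the term it came from; by \<open>e2_V\<close> any term of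
    \<open>S\<close> with head \<open>f\<close> gives the same value.\<close>
  define \<tau> where "\<tau> c = (if c \<in> new_cells z
    then (case c of FCell f n \<Rightarrow> Some (e2 (V f (SOME t. (f, t) \<in> set S))) | CCell _ \<Rightarrow> Some 0)
    else None)" for c
  have "dom \<tau> = new_cells z"
  proof -
    have "c \<in> dom \<tau> \<longleftrightarrow> c \<in> new_cells z" for c
      by (cases "c \<in> new_cells z"; cases c) (simp_all add: \<tau>_def domIff)
    then show ?thesis by blast
  qed
  have \<tau>_S: "\<tau> (FCell f (eval J (\<lambda>_. z) t)) = Some (e2 (V f t))" if "(f, t) \<in> set S" for f t
  proof -
    have "(f, SOME t. (f, t) \<in> set S) \<in> set S" using that by (rule someI)
    then have "e2 (V f (SOME t. (f, t) \<in> set S)) = e2 (V f t)" using that by (intro e2_V)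
    then show ?thesis using that by (auto simp: \<tau>_def new_cells_def)
  qed
  have \<tau>_rest: "\<tau> (FCell f (eval J (\<lambda>_. z) t)) = None" if "(f, t) \<in> set (apps Q) - set S" for f t
    using rest_not_new[OF that] by (simp add: \<tau>_def)
  have \<tau>_const: "\<tau> (CCell c) = None" for c
    by (auto simp: \<tau>_def new_cells_def)
  have "holds J' (e(X := z)) Q" if J': "agrees (K ++ \<tau>) J'" for J' e
  proof -
    have agr: "J' c = n" if "(K ++ \<tau>) c = Some n" for c n
      using J' that unfolding agrees_def by force
    have con: "J' (CCell c) = J (CCell c)" if "CCell c \<in> fm_cells J (\<lambda>_. z) Q" for c
      using const[OF that] \<tau>_const[of c] by (intro agr) (simp add: map_add_def)
    have app: "J' (FCell f (eval J' (e(X := z)) t)) = e2 (if (f, t) \<in> set S then V f t else U f t)"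
      if ft: "(f, t) \<in> set (apps Q)" for f t
    proof -
      have flat: "trm_apps t = []" using fragmentD(5)[OF fragment ft] .
      have "J' c = J c" if "c \<in> trm_cells J (\<lambda>_. z) t" for c
        using that con fm_cells_mono[OF ft, of J "\<lambda>_. z"] flat
        by (cases c) (auto simp: FCell_trm_cells)
      \<comment> \<open>The argument contains no unary symbol, so only constants are read, and on
        these \<open>J'\<close> and \<open>J\<close> agree.\<close>
      then have ev: "eval J' (e(X := z)) t = eval J (\<lambda>_. z) t"
        using free_vars_mono[OF ft Q(1)] Q(2) by (intro eval_cong) auto
      show ?thesis
      proof (cases "(f, t) \<in> set S")
        case True
        then show ?thesis unfolding ev using \<tau>_S by (auto intro!: agr)
      next
        case False
        then have r: "(f, t) \<in> set (apps Q) - set S" using ft by blast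
        then have "K (FCell f (eval J (\<lambda>_. z) t)) = Some (e2 (U f t))"
          using cells e2_U by fastforce
        then show ?thesis unfolding ev using False \<tau>_rest[OF r]
          by (auto intro!: agr simp: map_add_def)
      qed
    qed
    have "holds J e2 (abstract S Q) \<longleftrightarrow> holds J' (e(X := z)) Q"
      using Q con e2_X app by (intro holds_abstract[of _ J "\<lambda>_. z"]) auto
    then show ?thesis using abs by simp
  qed
  then have "cell_models (K ++ \<tau>) (subst X z Q)"
    by (simp add: cell_models_def models_def holds_subst)
  with \<open>dom \<tau> = new_cells z\<close> show ?thesis by (rule that)
qed

end

section \<open>Construction of the certificate\<close>

text \<open>The strict part is the inverse image of the order of the naturals, and injectivity gives
  antisymmetry.\<close>

lemma well_order_on_inj_nat:
  fixes h :: "'a \<Rightarrow> nat"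
  assumes "inj h"
  shows "well_order_on UNIV {(a, b). h a \<le> h b}"
proof -
  have "{(a, b). h a \<le> h b} - Id = inv_image less_than h"
    using assms by (auto simp: inv_image_def less_le inj_eq)
  then have "wf ({(a, b). h a \<le> h b} - Id)" by simp
  moreover have "antisym {(a, b). h a \<le> h b}"
    using assms by (intro antisymI) (simp add: inj_eq)
  moreover have "refl {(a, b). h a \<le> h b}" "trans {(a, b). h a \<le> h b}"
    "total {(a, b). h a \<le> h b}"
    by (auto intro!: refl_onI transI simp: total_on_def)
  ultimately show ?thesis
    by (simp add: well_order_on_def linear_order_on_def partial_order_on_def preorder_on_def)
qed

lemma certificate_exists:
  fixes F Q :: "('f, 'c) fm"
  assumes frag: "fragment F Q" and B: "bmin \<le> bmax"
    and FB: "models J (AndF F (instances Q bmin bmax))"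
    and pos: "extremal F Q bmin bmax J SPos S" and neg: "extremal F Q bmin bmax J SNeg S'"
  shows "\<exists>I R Xs. sat_certificate (AndF F (instances Q bmin bmax))
           (ImpF (outside bmin bmax) Q) I R Xs"
proof -
  interpret p: extremal F Q bmin bmax J SPos S by (fact pos)
  interpret n: extremal F Q bmin bmax J SNeg S' by (fact neg)
  let ?G = "AndF F (instances Q bmin bmax)" and ?P = "ImpF (outside bmin bmax) Q"

  \<comment> \<open>The finite cell interpretation\<close>
  have F: "qfree F" "free_vars F = {}" and Q: "qfree Q" "free_vars Q \<subseteq> {X}"
    using fragmentD[OF frag] by blast+
  define D where
    "D = fm_cells J (\<lambda>_. 0) F \<union> (\<Union>z \<in> {bmin..bmax}. fm_cells J (\<lambda>_. z) Q)"
  define I where "I = (\<lambda>c. if c \<in> D then Some (J c) else None)"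
  have dom_I: "dom I = D" by (auto simp: I_def dom_def)
  have agrees_I: "agrees I J' \<longleftrightarrow> (\<forall>c \<in> D. J' c = J c)" for J'
    unfolding agrees_def dom_I by (auto simp: I_def)
  \<comment> \<open>The constants of \<open>Q\<close> do not depend on \<open>x\<close>, so the
    instance at \<open>bmin\<close> already reads all of them; this uses that the interval is
    non-empty.\<close>
  have const_D: "CCell c \<in> D" if "CCell c \<in> fm_cells J (\<lambda>_. z) Q" for c z
  proof -
    have "CCell c \<in> fm_cells J (\<lambda>_. z) \<phi> \<longleftrightarrow> CCell c \<in> fm_cells J (\<lambda>_. bmin) \<phi>" for \<phi> :: "('f, 'c) fm"
      by (induction \<phi>) (auto intro: CCell_trm_cells[THEN iffD1])
    then show ?thesis using that B by (auto simp: D_def)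
  qed
  \<comment> \<open>Arguments in \<open>Q\<close> read constants only, so \<open>I\<close>
    determines them at every integer, inside the interval or not.\<close>
  have ev: "cell_eval I (trm_subst X z t) = Some (eval J (\<lambda>_. z) t)"
    if ft: "(f, t) \<in> set (apps Q)" for f t z
  proof (rule cell_eval_eqI[of _ J])
    show "agrees I J" by (simp add: agrees_I)
    fix J' e' assume J': "agrees I J'"
    have flat: "trm_apps t = []" using fragmentD(5)[OF frag ft] .
    have "c \<in> D" if "c \<in> trm_cells J (\<lambda>_. z) t" for c
      using that const_D[of _ z] fm_cells_mono[OF ft, of J "\<lambda>_. z"] flat
      by (cases c) (auto simp: FCell_trm_cells)
    then show "eval J' e' (trm_subst X z t) = eval J (\<lambda>_. z) t"
      unfolding eval_trm_subst using J' free_vars_mono[OF ft Q(1)] Q(2)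
      by (intro eval_cong) (auto simp: agrees_I)
  qed
  have \<Gamma>: "relevant_cells ?P I z = {FCell f (eval J (\<lambda>_. z) t) | f t. (f, t) \<in> set (apps Q)}" for z
    using ev by (fastforce simp: relevant_cells_def outside_def)
  have "cell_models I ?G"
    unfolding cell_models_def models_def
  proof (intro allI impI)
    fix J' e assume J': "agrees I J'"
    have "holds J' e F \<longleftrightarrow> holds J (\<lambda>_. 0) F"
      using J' F by (intro holds_cong) (auto simp: agrees_I D_def)
    moreover have "holds J' (e(X := z)) Q \<longleftrightarrow> holds J ((\<lambda>_. 0)(X := z)) Q"
      if "z \<in> {bmin..bmax}" for z
    proof -
      have "holds J' (e(X := z)) Q \<longleftrightarrow> holds J (\<lambda>_. z) Q"
        using J' Q that by (intro holds_cong) (auto simp: agrees_I D_def)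
      also have "\<dots> \<longleftrightarrow> holds J ((\<lambda>_. 0)(X := z)) Q"
        using Q by (intro holds_cong) auto
      finally show ?thesis .
    qed
    ultimately show "holds J' e ?G"
      using FB by (simp add: models_def instances_def holds_conj_list holds_subst)
  qed
  moreover have "finite (dom I)"
    unfolding dom_I D_def by (auto simp: finite_fm_cells)
  ultimately have pre: "pre_sat_certificate ?G ?P I"
    using ev by (fastforce simp: pre_sat_certificate_def outside_def)

  \<comment> \<open>Even codes for \<open>bmin\<close> and above, odd codes below: the order runs
    \<open>bmin\<close>, \<open>bmin - 1\<close>, \<open>bmin + 1\<close>, and so on. Hence all
    predecessors of a \<open>z\<close> above the interval are smaller than \<open>z\<close>, and all
    those of a \<open>z\<close> below it are larger.\<close>
  define h where "h z = (if z \<ge> bmin then 2 * (z - bmin) else 2 * (bmin - z) - 1)" for z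
  have h_nonneg: "h z \<ge> 0" for z by (simp add: h_def)
  have "inj (\<lambda>z. nat (h z))"
  proof (rule injI)
    fix x y assume "nat (h x) = nat (h y)"
    then have "h x = h y" using h_nonneg by (simp add: eq_nat_nat_iff)
    then show "x = y" unfolding h_def by presburger
  qed
  then have "well_order_on UNIV {(a, b). nat (h a) \<le> nat (h b)}"
    by (rule well_order_on_inj_nat)
  moreover define R where "R = {(a, b). h a \<le> h b}"
  ultimately have wo: "well_order_on UNIV R"
    using h_nonneg by (simp add: nat_le_eq_zle)

  define Xs where "Xs z =
    (if z > bmax then p.new_cells z else if z < bmin then n.new_cells z else {})" for z
  have p_F: "FCell f m \<notin> fm_cells J (\<lambda>_. 0) F"
    if "FCell f m \<in> p.new_cells z" "z > bmax" for f m z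
    using that p.ext_F[of f _ _ z] by (fastforce simp: p.new_cells_def FCell_fm_cells bound_def)
  \<comment> \<open>Serves twice: with \<open>z'\<close> in the interval for disjointness from
    \<open>dom I\<close>, and with \<open>z'\<close> an earlier integer for freshness.\<close>
  have p_Q: "FCell f (eval J (\<lambda>_. z') t') \<notin> p.new_cells z"
    if "z' < z" "(f, t') \<in> set (apps Q)" for f z z' t'
    using that p.ext_less[of f _ t' z' z] by (fastforce simp: p.new_cells_def)
  have n_F: "FCell f m \<notin> fm_cells J (\<lambda>_. 0) F"
    if "FCell f m \<in> n.new_cells z" "z < bmin" for f m z
    using that n.ext_F[of f _ _ z] by (fastforce simp: n.new_cells_def FCell_fm_cells bound_def)
  have n_Q: "FCell f (eval J (\<lambda>_. z') t') \<notin> n.new_cells z"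
    if "z' > z" "(f, t') \<in> set (apps Q)" for f z z' t'
    using that n.ext_less[of f _ t' z' z] by (fastforce simp: n.new_cells_def)

  \<comment> \<open>Relevance and freshness of the chosen cells\<close>
  have sub: "Xs z \<subseteq> relevant_cells ?P I z" for z
  proof -
    have "p.new_cells z \<subseteq> relevant_cells ?P I z" "n.new_cells z \<subseteq> relevant_cells ?P I z"
      unfolding \<Gamma> p.new_cells_def n.new_cells_def using p.S_apps n.S_apps by blast+
    then show ?thesis by (simp add: Xs_def)
  qed
  then have FC: "\<exists>f m. c = FCell f m" if "c \<in> Xs z" for c z
    using that unfolding \<Gamma> by blast
  have disj: "Xs z \<inter> dom I = {}" for z
  proof (rule ccontr)
    assume "Xs z \<inter> dom I \<noteq> {}"
    then obtain c where "c \<in> Xs z" "c \<in> D" unfolding dom_I by blast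
    with FC obtain f m where c: "FCell f m \<in> Xs z" "FCell f m \<in> D" by metis
    consider "FCell f m \<in> fm_cells J (\<lambda>_. 0) F"
      | z' t' where "bmin \<le> z'" "z' \<le> bmax" "(f, t') \<in> set (apps Q)"
          "FCell f m = FCell f (eval J (\<lambda>_. z') t')"
      using c(2) unfolding D_def by (auto simp: FCell_fm_cells)
    note D_cases = this
    show False
    proof (cases "z > bmax")
      case True
      then have "FCell f m \<in> p.new_cells z" using c by (simp add: Xs_def)
      then show False
        by (cases rule: D_cases) (use True p_F p_Q[of _ z] in auto)
    next
      case False
      then have "FCell f m \<in> n.new_cells z" "z < bmin" using c by (auto simp: Xs_def split: if_splits)
      then show False
        by (cases rule: D_cases) (use n_F n_Q[of z] in auto)
    qed
  qed
  have fresh: "Xs z \<inter> relevant_cells ?P I z' = {}" if R: "(z', z) \<in> R" "z' \<noteq> z" for z z'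
  proof (rule ccontr)
    assume "Xs z \<inter> relevant_cells ?P I z' \<noteq> {}"
    then obtain c where "c \<in> Xs z" "c \<in> relevant_cells ?P I z'" by blast
    with FC obtain f m where c: "FCell f m \<in> Xs z" "FCell f m \<in> relevant_cells ?P I z'" by metis
    then obtain t' where t': "FCell f m = FCell f (eval J (\<lambda>_. z') t')" "(f, t') \<in> set (apps Q)"
      by (auto simp: \<Gamma>)
    show False
    proof (cases "z > bmax")
      case True
      then have "z' < z" using R B by (auto simp: R_def h_def split: if_splits)
      then show False using c(1) t' True p_Q by (simp add: Xs_def)
    next
      case False
      then have z: "FCell f m \<in> n.new_cells z" "z < bmin" using c by (auto simp: Xs_def split: if_splits)
      then have "z' > z" using R B by (auto simp: R_def h_def split: if_splits)
      then show False using z(1) t' n_Q by simp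
    qed
  qed

  \<comment> \<open>Witnesses for the chosen cells\<close>
  have step: "\<exists>\<tau>. dom \<tau> = Xs z \<and> cell_models (I ++ \<rho> ++ \<tau>) (subst X z ?P)"
    if \<rho>: "dom \<rho> = relevant_cells ?P I z - dom I - Xs z" for \<rho> z
  proof -
    have K_const: "(I ++ \<rho>) (CCell c) = Some (J (CCell c))"
      if "CCell c \<in> fm_cells J (\<lambda>_. z) Q" for c
    proof -
      have "CCell c \<notin> dom \<rho>" unfolding \<rho> by (auto simp: \<Gamma>)
      then show ?thesis using const_D[OF that] by (auto simp: map_add_def I_def split: option.splits)
    qed
    \<comment> \<open>A relevant cell outside \<open>Xs z\<close> is defined by \<open>I\<close> or,
      failing that, by \<open>\<rho>\<close>.\<close>
    have K_dom: "FCell f (eval J (\<lambda>_. z) t) \<in> dom (I ++ \<rho>)"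
      if "(f, t) \<in> set (apps Q)" "FCell f (eval J (\<lambda>_. z) t) \<notin> Xs z" for f t
      using that unfolding dom_map_add \<rho> by (auto simp: \<Gamma>)
    have weaken: "cell_models K (subst X z Q) \<Longrightarrow> cell_models K (subst X z ?P)" for K
      by (auto simp: cell_models_def models_def)
    consider "z > bmax" | "z < bmin" "\<not> z > bmax" | "bmin \<le> z" "z \<le> bmax" by linarith
    then show ?thesis
    proof cases
      case 1
      have "FCell f (eval J (\<lambda>_. z) t) \<in> dom (I ++ \<rho>)" if "(f, t) \<in> set (apps Q) - set S" for f t
        using that 1 p.rest_not_new[OF that] by (intro K_dom) (auto simp: Xs_def)
      with K_const obtain \<tau> where "dom \<tau> = p.new_cells z"
        "cell_models (I ++ \<rho> ++ \<tau>) (subst X z Q)" by (rule p.propagate)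
      then show ?thesis using weaken 1 by (auto simp: Xs_def)
    next
      case 2
      have "FCell f (eval J (\<lambda>_. z) t) \<in> dom (I ++ \<rho>)" if "(f, t) \<in> set (apps Q) - set S'" for f t
        using that 2 n.rest_not_new[OF that] by (intro K_dom) (auto simp: Xs_def)
      with K_const obtain \<tau> where "dom \<tau> = n.new_cells z"
        "cell_models (I ++ \<rho> ++ \<tau>) (subst X z Q)" by (rule n.propagate)
      then show ?thesis using weaken 2 by (auto simp: Xs_def)
    next
      case 3
      \<comment> \<open>Inside the interval the guard \<open>outside\<close> is false, so the
        implication holds without choosing any cell.\<close>
      then have "cell_models K (subst X z ?P)" for K
        by (auto simp: cell_models_def models_def outside_def)
      then show ?thesis using 3 by (intro exI[of _ Map.empty]) (auto simp: Xs_def)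
    qed
  qed
  have "sat_certificate ?G ?P I R Xs"
    unfolding sat_certificate_def using pre wo sub disj fresh step by blast
  then show ?thesis by blast
qed

theorem theorem2:
  fixes F Q :: "('f, 'c) fm" and bmin bmax :: int
  assumes "fragment F Q"
    and "bmin \<le> bmax"
    and "satisfiable
           (AndF (AndF F (instances Q bmin bmax))
             (AndF (disj_list [Psi F Q SPos bmin bmax S. S \<leftarrow> subseqs (app_terms Q)])
                   (disj_list [Psi F Q SNeg bmin bmax S'. S' \<leftarrow> subseqs (app_terms Q)])))"
  shows "has_sat_certificate
           (AndF (AndF F (instances Q bmin bmax)) (AllF X (ImpF (outside bmin bmax) Q)))
         \<and> satisfiable (AndF F (AllF X Q))"
proof -
  let ?G = "AndF F (instances Q bmin bmax)" and ?P = "ImpF (outside bmin bmax) Q"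
  obtain J where J: "models J ?G"
    and disj: "holds J (\<lambda>_. 0) (disj_list [Psi F Q SPos bmin bmax S. S \<leftarrow> subseqs (app_terms Q)])"
      "holds J (\<lambda>_. 0) (disj_list [Psi F Q SNeg bmin bmax S. S \<leftarrow> subseqs (app_terms Q)])"
    using assms(3) unfolding satisfiable_def models_def holds.simps by blast
  have "\<exists>S. extremal F Q bmin bmax J s S"
    if s: "holds J (\<lambda>_. 0) (disj_list [Psi F Q s bmin bmax S. S \<leftarrow> subseqs (app_terms Q)])" for s
  proof -
    obtain S where S: "S \<in> set (subseqs (app_terms Q))" "holds J (\<lambda>_. 0) (Psi F Q s bmin bmax S)"
      using s unfolding holds_disj_list by auto
    then have "set S \<subseteq> set (apps Q)"
      using subseqs_powset[of "app_terms Q"] by (auto simp: app_terms_def)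
    with S assms(1) have "extremal F Q bmin bmax J s S" by (simp add: extremal_def)
    then show ?thesis ..
  qed
  from this[OF disj(1)] this[OF disj(2)]
  obtain I R Xs where cert: "sat_certificate ?G ?P I R Xs"
    using certificate_exists[OF assms(1,2) J] by blast
  have "has_sat_certificate (AndF ?G (AllF X ?P))"
  proof -
    have "qfree ?G" "qfree ?P" "free_vars ?G = {}" "free_vars ?P \<subseteq> {X}"
      using fragmentD(1-4)[OF assms(1)]
      by (auto simp: instances_def outside_def qfree_conj_list free_vars_conj_list
          qfree_subst free_vars_subst)
    then show ?thesis unfolding has_sat_certificate_def using cert by blast
  qed
  moreover from cert obtain J' where J': "models J' (AndF ?G (AllF X ?P))"
    by (rule sat_certificate_sound)
  \<comment> \<open>The instances give \<open>Q\<close> inside the interval, the guarded universal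
    formula outside it.\<close>
  have "holds J' (e(X := z)) Q" for e z
    using J' by (cases "bmin \<le> z \<and> z \<le> bmax")
      (auto simp: models_def instances_def holds_conj_list holds_subst outside_def)
  then have "satisfiable (AndF F (AllF X Q))"
    using J' unfolding satisfiable_def by (intro exI[of _ J']) (simp add: models_def)
  ultimately show ?thesis by blast
qed

end
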